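(* Let $f:(\mathbb{R}^2,0)\to(\mathbb{R}^3,0)$ be a Whitney umbrella, let $\gamma:\mathbb{R}\to l^\perp$ be its curvature parabola in the normal plane $l^\perp$, and let $P_{(\gamma,0)}$ be the pedal curve of $\gamma$ with respect to the origin. Then the inversion in the unit circle of the image of the pedal curve coincides with the focal conic of $f$: $$i\big(P_{(\gamma,0)}(\mathbb{R})\big)=FC(f).$$
   Context: All maps and germs are $C^\infty$. A map-germ $f:(\mathbb{R}^2,0)\to(\mathbb{R}^3,0)$ is a Whitney umbrella if there are diffeomorphism-germs $\lambda$ of $(\mathbb{R}^2,0)$ and $\mu$ of $(\mathbb{R}^3,0)$ with $\mu\circ f\circ\lambda^{-1}(u,v)=(u,v^2,uv)$. Curvature parabola: let $l=df_0(T_0\mathbb{R}^2)$ (a line), $l^\perp$ its orthogonal complement in $\mathbb{R}^3$ (the normal plane), and $\pi_l:\mathbb{R}^3\to l^\perp$ the orthogonal projection. For $X=a\partial_u+b\partial_v$ let $\mathrm{I}(X,X)=a^2\,f_u\cdot f_u+2ab\,f_u\cdot f_v+b^2\,f_v\cdot f_v$ and $\mathrm{II}(X,X)=\pi_l(a^2f_{uu}+2abf_{uv}+b^2f_{vv})$, all evaluated at $0$. The set $\{\mathrm{II}(X,X): \mathrm{I}(X,X)=1,\ a,b\in\mathbb{R}\}$ is a non-degenerate parabola in $l^\perp$, called the curvature parabola; $\gamma:\mathbb{R}\to l^\perp$ denotes a regular parametrization of it. Pedal curve: for a plane curve $\gamma$ with nowhere-vanishing tangent vector field $e$ (perpendicular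 to its unit normal), the pedal curve with respect to a point $p$ is $P_{(\gamma,p)}=\gamma+\dfrac{e\cdot(p-\gamma)}{e\cdot e}\,e$. Inversion: $i:\mathbb{R}^2\setminus\{0\}\to\mathbb{R}^2\setminus\{0\}$, $i(x_1,x_2)=(x_1,x_2)/(x_1^2+x_2^2)$; the inversion on $l^\perp$ is defined by identifying $(l^\perp,0)$ isometrically with $(\mathbb{R}^2,0)$. For a set $A\subset l^\perp$, $i(A)$ means the image under $i$ of $A\setminus\{0\}$. Focal conic: $FC(f)$ is the set of points $x\in\mathbb{R}^3$ for which the distance squared function $d_x(u,v)=|f(u,v)-x|^2$ has a degenerate critical point at $(u,v)=(0,0)$. For a Whitney umbrella it is contained in $l^\perp$ and is a conic.
   Formalization: The printed equality fails at the origin for every Whitney umbrella, since 0 lies in FC(f) but never in an image of the inversion; what is proved is that i(P(ℝ)) equals FC(f) without the origin, and that the origin belongs to FC(f). *)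

theory Defs
  imports "HOL-Analysis.Analysis"
begin

(* The set S is meant to be open. *)
primrec Ck_on :: "nat \<Rightarrow> ('a::real_normed_vector \<Rightarrow> 'b::real_normed_vector) \<Rightarrow> 'a set \<Rightarrow> bool" where
  "Ck_on 0 f S \<longleftrightarrow> continuous_on S f"
| "Ck_on (Suc k) f S \<longleftrightarrow>
     (\<forall>x\<in>S. f differentiable at x) \<and> (\<forall>v. Ck_on k (\<lambda>x. frechet_derivative f (at x) v) S)"

definition smooth_on :: "('a::real_normed_vector \<Rightarrow> 'b::real_normed_vector) \<Rightarrow> 'a set \<Rightarrow> bool" where
  "smooth_on f S \<longleftrightarrow> (\<forall>k. Ck_on k f S)"

(* A map-germ is represented by a total function whose values away from 0 are irrelevant. *)
definition smooth_germ :: "('a::real_normed_vector \<Rightarrow> 'b::real_normed_vector) \<Rightarrow> bool" where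
  "smooth_germ f \<longleftrightarrow> f 0 = 0 \<and> (\<exists>U. open U \<and> 0 \<in> U \<and> smooth_on f U)"

(* g is a diffeomorphism-germ at 0 and h represents the inverse germ of g. *)
definition diffeo_germ_pair ::
  "('a::real_normed_vector \<Rightarrow> 'a) \<Rightarrow> ('a \<Rightarrow> 'a) \<Rightarrow> bool" where
  "diffeo_germ_pair g h \<longleftrightarrow> smooth_germ g \<and> smooth_germ h \<and>
     (\<forall>\<^sub>F x in nhds 0. h (g x) = x) \<and> (\<forall>\<^sub>F y in nhds 0. g (h y) = y)"

definition whitney_umbrella :: "(real^2 \<Rightarrow> real^3) \<Rightarrow> bool" where
  "whitney_umbrella f \<longleftrightarrow> smooth_germ f \<and>
     (\<exists>lam lam' mu mu'. diffeo_germ_pair lam lam' \<and> diffeo_germ_pair mu mu' \<and>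
        (\<forall>\<^sub>F w in nhds 0. mu (f (lam' w)) = vector [w$1, (w$2)\<^sup>2, w$1 * w$2]))"

(* Partial derivative; the coordinates u, v of the plane are the components 1, 2. *)
definition pderivative ::
  "'n::finite \<Rightarrow> (real^'n \<Rightarrow> 'b::real_normed_vector) \<Rightarrow> real^'n \<Rightarrow> 'b" where
  "pderivative i f x = frechet_derivative f (at x) (axis i 1)"

definition tangent_line :: "(real^2 \<Rightarrow> real^3) \<Rightarrow> (real^3) set" where
  "tangent_line f = range (frechet_derivative f (at 0))"

definition normal_plane :: "(real^2 \<Rightarrow> real^3) \<Rightarrow> (real^3) set" where
  "normal_plane f = orthogonal_comp (tangent_line f)"

(* The orthogonal projection along the tangent line; the decomposition of y is unique. *)
definition normal_proj :: "(real^2 \<Rightarrow> real^3) \<Rightarrow> real^3 \<Rightarrow> real^3" where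
  "normal_proj f y = (THE z. z \<in> normal_plane f \<and> y - z \<in> tangent_line f)"

definition first_form :: "(real^2 \<Rightarrow> real^3) \<Rightarrow> real \<Rightarrow> real \<Rightarrow> real" where
  "first_form f a b =
     (let fu = pderivative 1 f 0; fv = pderivative 2 f 0
      in a\<^sup>2 * (fu \<bullet> fu) + 2 * a * b * (fu \<bullet> fv) + b\<^sup>2 * (fv \<bullet> fv))"

definition second_form :: "(real^2 \<Rightarrow> real^3) \<Rightarrow> real \<Rightarrow> real \<Rightarrow> real^3" where
  "second_form f a b =
     (let fuu = pderivative 1 (pderivative 1 f) 0;
          fuv = pderivative 2 (pderivative 1 f) 0;
          fvv = pderivative 2 (pderivative 2 f) 0
      in normal_proj f (a\<^sup>2 *\<^sub>R fuu + (2 * a * b) *\<^sub>R fuv + b\<^sup>2 *\<^sub>R fvv))"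

definition curvature_parabola :: "(real^2 \<Rightarrow> real^3) \<Rightarrow> (real^3) set" where
  "curvature_parabola f = {second_form f a b | a b. first_form f a b = 1}"

definition regular_parametrization ::
  "(real \<Rightarrow> 'a::real_normed_vector) \<Rightarrow> 'a set \<Rightarrow> bool" where
  "regular_parametrization \<gamma> C \<longleftrightarrow> smooth_on \<gamma> UNIV \<and>
     (\<forall>t. vector_derivative \<gamma> (at t) \<noteq> 0) \<and> range \<gamma> = C"

definition tangent_field ::
  "(real \<Rightarrow> 'a::real_normed_vector) \<Rightarrow> (real \<Rightarrow> 'a) \<Rightarrow> bool" where
  "tangent_field \<gamma> e \<longleftrightarrow> smooth_on e UNIV \<and>
     (\<forall>t. e t \<noteq> 0 \<and> vector_derivative \<gamma> (at t) \<in> span {e t})"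

definition pedal_curve ::
  "(real \<Rightarrow> 'a::real_inner) \<Rightarrow> (real \<Rightarrow> 'a) \<Rightarrow> 'a \<Rightarrow> real \<Rightarrow> 'a" where
  "pedal_curve \<gamma> e p t = \<gamma> t + ((e t \<bullet> (p - \<gamma> t)) / (e t \<bullet> e t)) *\<^sub>R e t"

(* The formula only involves the norm, so its restriction to a plane through 0 is the planar
   inversion under any linear isometry of that plane with real^2. *)
definition inversion :: "'a::real_inner \<Rightarrow> 'a" where
  "inversion x = x /\<^sub>R (norm x)\<^sup>2"

definition inversion_image :: "'a::real_inner set \<Rightarrow> 'a set" where
  "inversion_image A = inversion ` (A - {0})"

definition degenerate_critical_point :: "(real^'n \<Rightarrow> real) \<Rightarrow> real^'n \<Rightarrow> bool" where
  "degenerate_critical_point g x \<longleftrightarrow>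
     (g has_derivative (\<lambda>_. 0)) (at x) \<and>
     det (\<chi> i j. pderivative i (pderivative j g) x) = 0"

(* For a Whitney umbrella this contains 0, where the Hessian X |-> 2 * first_form of the squared
   norm of f has rank 1, whereas an inversion_image never contains 0; the two sets can therefore
   only be compared away from 0. *)
definition focal_conic :: "(real^2 \<Rightarrow> real^3) \<Rightarrow> (real^3) set" where
  "focal_conic f = {x. degenerate_critical_point (\<lambda>w. (norm (f w - x))\<^sup>2) 0}"

end

theory Submission
  imports Defs
begin

text \<open>
  Write \<open>A\<close> for the derivative and \<open>B\<close> for the symmetric second derivative of \<open>f\<close> at \<open>0\<close>. Differentiating
  \<open>f = \<mu>\<inverse> \<circ> (u, v\<^sup>2, uv) \<circ> \<lambda>\<close> twice gives vectors \<open>X\<close> and \<open>k\<close> such that \<open>A X\<close> is a unit vector, \<open>A k = 0\<close>,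
  and \<open>A X\<close>, \<open>B X k\<close>, \<open>B k k\<close> are linearly independent. If \<open>p, q, r\<close> are the normal parts of
  \<open>B X X\<close>, \<open>B X k\<close>, \<open>B k k\<close>, the curvature parabola is \<open>s \<mapsto> p + 2 s q + s\<^sup>2 r\<close>. For \<open>x\<close> in the normal
  plane the Hessian of the distance squared function is twice the form \<open>A Y \<bullet> A Z - x \<bullet> B Y Z\<close>. If
  \<open>x \<noteq> 0\<close>, a null vector of this form is a multiple of some \<open>X + s k\<close>, which means that \<open>x\<close> is orthogonal
  to the tangent vector \<open>q + s r\<close> and has inner product \<open>1\<close> with the point of the parabola at \<open>s\<close>. This
  says exactly that \<open>x\<close> is the inverse of the foot of the perpendicular from \<open>0\<close> to that tangent line.
\<close>

section \<open>Second derivatives\<close>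

definition second_derivative ::
  "('a::real_normed_vector \<Rightarrow> 'b::real_normed_vector) \<Rightarrow> 'a \<Rightarrow> 'a \<Rightarrow> 'a \<Rightarrow> 'b" where
  "second_derivative f x X Y = frechet_derivative (\<lambda>y. frechet_derivative f (at y) X) (at x) Y"

lemma smooth_on_has_derivative:
  assumes "smooth_on f U" "x \<in> U"
  shows "(f has_derivative frechet_derivative f (at x)) (at x)"
proof -
  have "Ck_on (Suc 0) f U"
    using assms unfolding smooth_on_def by blast
  then show ?thesis
    using assms by (simp add: frechet_derivative_works)
qed

lemma smooth_on_frechet_derivative:
  assumes "smooth_on f U"
  shows "smooth_on (\<lambda>x. frechet_derivative f (at x) v) U"
proof -
  have "Ck_on k (\<lambda>x. frechet_derivative f (at x) v) U" for k
  proof -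
    have "Ck_on (Suc k) f U" using assms unfolding smooth_on_def by blast
    then show ?thesis by simp
  qed
  then show ?thesis unfolding smooth_on_def by blast
qed

lemma smooth_on_continuous_on:
  assumes "smooth_on f U"
  shows "continuous_on U f"
proof -
  have "Ck_on 0 f U" using assms unfolding smooth_on_def by blast
  then show ?thesis by simp
qed

lemma smooth_on_has_second_derivative:
  assumes "smooth_on f U" "x \<in> U"
  shows "((\<lambda>y. frechet_derivative f (at y) X) has_derivative second_derivative f x X) (at x)"
  using smooth_on_has_derivative[OF smooth_on_frechet_derivative[OF assms(1)] assms(2)]
  unfolding second_derivative_def [abs_def] .

lemma smooth_on_second_derivative:
  assumes "smooth_on f U"
  shows "smooth_on (\<lambda>x. second_derivative f x X Y) U"
  unfolding second_derivative_def
  by (intro smooth_on_frechet_derivative assms)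

lemma second_derivative_linear_right:
  assumes "smooth_on f U" "x \<in> U"
  shows "linear (second_derivative f x X)"
  using smooth_on_has_second_derivative[OF assms] has_derivative_linear by blast

text \<open>PLACEHOLDER

  The two entries above are a false start and should be discarded. The complete list is:\<close>

lemma second_derivative_linear_left:
  assumes "smooth_on f U" "open U" "x \<in> U"
  shows "linear (\<lambda>X. second_derivative f x X Y)"
proof -
  have lin: "linear (frechet_derivative f (at y))" if "y \<in> U" for y
    using smooth_on_has_derivative[OF assms(1) that] has_derivative_linear by blast
  note D = smooth_on_has_second_derivative[OF assms(1,3)]
  show ?thesis
  proof (rule linearI)
    fix X X'
    have "((\<lambda>y. frechet_derivative f (at y) (X + X')) has_derivative
        (\<lambda>Y. second_derivative f x X Y + second_derivative f x X' Y)) (at x)"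
      by (rule has_derivative_transform_within_open[OF has_derivative_add[OF D D] assms(2,3)])
        (simp add: linear_add[OF lin])
    then show "second_derivative f x (X + X') Y
        = second_derivative f x X Y + second_derivative f x X' Y"
      using has_derivative_unique[OF D] by metis
  next
    fix c X
    have "((\<lambda>y. frechet_derivative f (at y) (c *\<^sub>R X)) has_derivative
        (\<lambda>Y. c *\<^sub>R second_derivative f x X Y)) (at x)"
      by (rule has_derivative_transform_within_open[OF has_derivative_scaleR_right[OF D] assms(2,3)])
        (simp add: linear_scale[OF lin])
    then show "second_derivative f x (c *\<^sub>R X) Y = c *\<^sub>R second_derivative f x X Y"
      using has_derivative_unique[OF D] by metis
  qed
qed

section \<open>Symmetry of second derivatives, by the mean value theorem\<close>

lemma DERIV_inner_along_line:
  fixes f :: "'a::real_normed_vector \<Rightarrow> 'b::real_inner"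
  assumes "(f has_derivative f') (at (a + s *\<^sub>R v))"
  shows "((\<lambda>s. f (a + s *\<^sub>R v) \<bullet> c) has_real_derivative f' v \<bullet> c) (at s)"
proof -
  have "((\<lambda>s. a + s *\<^sub>R v) has_derivative (\<lambda>h. h *\<^sub>R v)) (at s)"
    by (auto intro!: derivative_eq_intros)
  from has_derivative_inner_left[OF has_derivative_compose[OF this assms]]
  have "((\<lambda>s. f (a + s *\<^sub>R v) \<bullet> c) has_derivative (\<lambda>h. f' (h *\<^sub>R v) \<bullet> c)) (at s)" .
  moreover have "f' (h *\<^sub>R v) = h *\<^sub>R f' v" for h
    using has_derivative_linear[OF assms] by (rule linear_scale)
  then have "(\<lambda>h. f' (h *\<^sub>R v) \<bullet> c) = (*) (f' v \<bullet> c)"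
    by (simp add: fun_eq_iff)
  ultimately show ?thesis
    by (simp add: has_field_derivative_def)
qed

text \<open>The mean value theorem is applied once in direction \<open>X\<close> and once in
  direction \<open>Y\<close>. It needs real values, hence the pairing with a fixed vector
  \<open>c\<close>.\<close>

lemma second_difference_mvt:
  fixes f :: "'a::real_normed_vector \<Rightarrow> 'b::real_inner"
  assumes f: "smooth_on f U" and h: "0 < h" and U: "cball x (h * (norm X + norm Y)) \<subseteq> U"
  obtains p where "p \<in> cball x (h * (norm X + norm Y))"
    and "(f (x + h *\<^sub>R X + h *\<^sub>R Y) - f (x + h *\<^sub>R X) - f (x + h *\<^sub>R Y) + f x) \<bullet> c
      = h * (h * (second_derivative f p X Y \<bullet> c))"
proof -
  have mem: "x + s *\<^sub>R X + t *\<^sub>R Y \<in> cball x (h * (norm X + norm Y))"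
    if "0 \<le> s" "s \<le> h" "0 \<le> t" "t \<le> h" for s t
  proof -
    have "norm (s *\<^sub>R X + t *\<^sub>R Y) \<le> s * norm X + t * norm Y"
      using that norm_triangle_ineq[of "s *\<^sub>R X" "t *\<^sub>R Y"] by simp
    also have "\<dots> \<le> h * norm X + h * norm Y"
      using that by (intro add_mono mult_right_mono) auto
    finally have "norm (- (s *\<^sub>R X + t *\<^sub>R Y)) \<le> h * (norm X + norm Y)"
      by (simp only: norm_minus_cancel distrib_left)
    moreover have "x - (x + s *\<^sub>R X + t *\<^sub>R Y) = - (s *\<^sub>R X + t *\<^sub>R Y)"
      by simp
    ultimately show ?thesis
      by (simp only: mem_cball dist_norm)
  qed
  let ?D = "\<lambda>y. frechet_derivative f (at y)"
  \<comment> \<open>The second difference is the increment over \<open>[0, h]\<close> of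
    \<open>s\<close> mapped to \<open>f (x + h Y + s X) - f (x + s X)\<close>, paired with
    \<open>c\<close>. The terms with factor 0 match the endpoint form of
    \<open>MVT2\<close>.\<close>
  have "\<exists>z>0. z < h \<and>
    (f (x + h *\<^sub>R Y + h *\<^sub>R X) \<bullet> c - f (x + h *\<^sub>R X) \<bullet> c)
      - (f (x + h *\<^sub>R Y + 0 *\<^sub>R X) \<bullet> c - f (x + 0 *\<^sub>R X) \<bullet> c)
    = (h - 0) * (?D (x + h *\<^sub>R Y + z *\<^sub>R X) X \<bullet> c - ?D (x + z *\<^sub>R X) X \<bullet> c)"
  proof (rule MVT2[OF h])
    fix s assume s: "0 \<le> s" "s \<le> h"
    have "x + h *\<^sub>R Y + s *\<^sub>R X \<in> U" "x + s *\<^sub>R X \<in> U"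
      using mem[OF s, of h] mem[OF s, of 0] h U by (auto simp: algebra_simps)
    then show "((\<lambda>s. f (x + h *\<^sub>R Y + s *\<^sub>R X) \<bullet> c - f (x + s *\<^sub>R X) \<bullet> c) has_real_derivative
        ?D (x + h *\<^sub>R Y + s *\<^sub>R X) X \<bullet> c - ?D (x + s *\<^sub>R X) X \<bullet> c) (at s)"
      by (intro DERIV_diff DERIV_inner_along_line smooth_on_has_derivative[OF f])
  qed
  then obtain s where s: "0 < s" "s < h" and 1:
    "(f (x + h *\<^sub>R X + h *\<^sub>R Y) - f (x + h *\<^sub>R X) - f (x + h *\<^sub>R Y) + f x) \<bullet> c
      = h * (?D (x + s *\<^sub>R X + h *\<^sub>R Y) X \<bullet> c - ?D (x + s *\<^sub>R X + 0 *\<^sub>R Y) X \<bullet> c)"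
    by (auto simp: inner_simps algebra_simps)
  have "\<exists>z>0. z < h \<and>
     ?D (x + s *\<^sub>R X + h *\<^sub>R Y) X \<bullet> c - ?D (x + s *\<^sub>R X + 0 *\<^sub>R Y) X \<bullet> c
     = (h - 0) * (second_derivative f (x + s *\<^sub>R X + z *\<^sub>R Y) X Y \<bullet> c)"
  proof (rule MVT2[OF h])
    fix t assume t: "0 \<le> t" "t \<le> h"
    have "x + s *\<^sub>R X + t *\<^sub>R Y \<in> U"
      using mem[of s t] s t U by auto
    then show "((\<lambda>t. ?D (x + s *\<^sub>R X + t *\<^sub>R Y) X \<bullet> c) has_real_derivative
        second_derivative f (x + s *\<^sub>R X + t *\<^sub>R Y) X Y \<bullet> c) (at t)"
      by (intro DERIV_inner_along_line smooth_on_has_second_derivative[OF f])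
  qed
  then obtain t where t: "0 < t" "t < h" and
    "?D (x + s *\<^sub>R X + h *\<^sub>R Y) X \<bullet> c - ?D (x + s *\<^sub>R X + 0 *\<^sub>R Y) X \<bullet> c
     = h * (second_derivative f (x + s *\<^sub>R X + t *\<^sub>R Y) X Y \<bullet> c)"
    by auto
  with 1 show ?thesis
    using that[OF mem[of s t]] s by simp
qed

text \<open>The second difference is symmetric in \<open>X\<close> and \<open>Y\<close>, so the two
  mixed derivatives, paired with \<open>c\<close>, agree at suitable points arbitrarily close to
  \<open>x\<close>. Continuity carries the equality to \<open>x\<close>.\<close>

lemma second_derivative_commute:
  fixes f :: "'a::real_normed_vector \<Rightarrow> 'b::real_inner"
  assumes f: "smooth_on f U" and U: "open U" "x \<in> U"
  shows "second_derivative f x X Y = second_derivative f x Y X"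
proof -
  \<comment> \<open>Pairing with the difference itself turns the claim into
    \<open>c \<bullet> c = 0\<close>.\<close>
  define c where "c = second_derivative f x X Y - second_derivative f x Y X"
  let ?F = "\<lambda>y. second_derivative f y X Y \<bullet> c" and ?G = "\<lambda>y. second_derivative f y Y X \<bullet> c"
  \<comment> \<open>The summand 1 keeps \<open>K\<close> positive even for \<open>X = Y = 0\<close>,
    so that division by \<open>K\<close> is possible.\<close>
  define K where "K = norm X + norm Y + 1"
  have K: "K > 0" "norm X + norm Y \<le> K"
    unfolding K_def by (simp_all add: add_nonneg_pos)
  have cont: "isCont ?F x" "isCont ?G x"
    using smooth_on_continuous_on[OF smooth_on_second_derivative[OF f]] U
    by (auto intro!: isCont_inner simp: continuous_on_eq_continuous_at)
  have "\<bar>?F x - ?G x\<bar> \<le> e" if "e > 0" for e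
  proof -
    have "\<exists>d>0. \<forall>y. dist y x < d \<longrightarrow> dist (?F y) (?F x) < e / 2"
      "\<exists>d>0. \<forall>y. dist y x < d \<longrightarrow> dist (?G y) (?G x) < e / 2"
      using cont \<open>e > 0\<close> unfolding continuous_at_eps_delta
      by (meson half_gt_zero)+
    then obtain d1 d2 where d1: "d1 > 0" "\<And>y. dist y x < d1 \<Longrightarrow> dist (?F y) (?F x) < e / 2"
      and d2: "d2 > 0" "\<And>y. dist y x < d2 \<Longrightarrow> dist (?G y) (?G x) < e / 2"
      by blast
    obtain d3 where d3: "d3 > 0" "ball x d3 \<subseteq> U"
      using U openE by blast
    define d where "d = Min {d1, d2, d3}"
    have d: "d > 0" "d \<le> d1" "d \<le> d2" "d \<le> d3"
      unfolding d_def using d1(1) d2(1) d3(1) by auto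
    define h where "h = d / (2 * K)"
    have h: "h > 0" "h * (norm X + norm Y) < d"
    proof -
      show h: "h > 0" unfolding h_def using d(1) K by simp
      have "h * (norm X + norm Y) \<le> h * K"
        using h K by (intro mult_left_mono) auto
      also have "\<dots> < d" unfolding h_def using d(1) K by (simp add: field_simps)
      finally show "h * (norm X + norm Y) < d" .
    qed
    have sub: "cball x (h * (norm X + norm Y)) \<subseteq> U" "cball x (h * (norm Y + norm X)) \<subseteq> U"
      using h(2) d d3(2) by (auto simp: subset_iff add.commute)
    obtain y where y: "y \<in> cball x (h * (norm X + norm Y))" and
      "(f (x + h *\<^sub>R X + h *\<^sub>R Y) - f (x + h *\<^sub>R X) - f (x + h *\<^sub>R Y) + f x) \<bullet> c = h * (h * ?F y)"
      using second_difference_mvt[OF f h(1) sub(1)] by blast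
    moreover obtain z where z: "z \<in> cball x (h * (norm Y + norm X))" and
      "(f (x + h *\<^sub>R Y + h *\<^sub>R X) - f (x + h *\<^sub>R Y) - f (x + h *\<^sub>R X) + f x) \<bullet> c = h * (h * ?G z)"
      using second_difference_mvt[OF f h(1) sub(2)] by blast
    ultimately have "h * (h * ?F y) = h * (h * ?G z)"
      by (simp add: algebra_simps)
    then have "?F y = ?G z" using h(1) by simp
    moreover have "dist y x < d1" "dist z x < d2"
      using y z h(2) d by (auto simp: dist_commute add.commute)
    ultimately show ?thesis
      using d1(2)[of y] d2(2)[of z] unfolding dist_real_def by linarith
  qed
  then have "\<bar>?F x - ?G x\<bar> \<le> 0"
    by (rule field_le_epsilon) simp
  then have "c \<bullet> c = 0" by (simp add: c_def inner_diff_left)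
  then show ?thesis by (simp add: c_def)
qed

section \<open>The 2-jet of a Whitney umbrella\<close>

lemma isCont_tendsto_nhds: "isCont g a \<Longrightarrow> (g \<longlongrightarrow> g a) (nhds a)"
  by (simp add: isCont_def tendsto_at_iff_tendsto_nhds)

lemma smooth_germ_continuous_at_0:
  assumes "smooth_germ g"
  shows "(g \<longlongrightarrow> 0) (nhds 0)"
proof -
  obtain U where U: "open U" "0 \<in> U" "smooth_on g U" and g0: "g 0 = 0"
    using assms unfolding smooth_germ_def by blast
  have "isCont g 0"
    using smooth_on_continuous_on[OF U(3)] U by (simp add: continuous_on_eq_continuous_at)
  then show ?thesis
    using isCont_tendsto_nhds g0 by metis
qed

lemma smooth_germ_has_derivative:
  assumes "smooth_germ g"
  shows "(g has_derivative frechet_derivative g (at 0)) (at 0)"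
  using assms smooth_on_has_derivative unfolding smooth_germ_def by blast

lemma diffeo_germ_pair_sym: "diffeo_germ_pair g h \<Longrightarrow> diffeo_germ_pair h g"
  unfolding diffeo_germ_pair_def by blast

text \<open>Chain rule for \<open>h (g x)\<close>, which is the identity near 0.\<close>

lemma diffeo_germ_pair_derivative_left_inverse:
  assumes "diffeo_germ_pair g h"
  shows "frechet_derivative h (at 0) (frechet_derivative g (at 0) v) = v"
proof -
  have g: "smooth_germ g" "smooth_germ h" and inv: "\<forall>\<^sub>F x in nhds 0. h (g x) = x"
    using assms unfolding diffeo_germ_pair_def by auto
  have "(h has_derivative frechet_derivative h (at 0)) (at (g 0))"
    using smooth_germ_has_derivative[OF g(2)] g(1) by (simp add: smooth_germ_def)
  with smooth_germ_has_derivative[OF g(1)]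
  have "((\<lambda>x. h (g x)) has_derivative
      (\<lambda>v. frechet_derivative h (at 0) (frechet_derivative g (at 0) v))) (at 0)"
    by (rule has_derivative_compose)
  moreover have "((\<lambda>x. h (g x)) has_derivative (\<lambda>v. v)) (at 0)"
  proof (rule has_derivative_transform_eventually[OF has_derivative_ident])
    show "\<forall>\<^sub>F x in at 0. x = h (g x)"
      using inv by (auto simp: eventually_nhds_conv_at elim: eventually_mono)
    show "0 = h (g 0)"
      using g by (simp add: smooth_germ_def)
  qed simp
  ultimately have "(\<lambda>v. frechet_derivative h (at 0) (frechet_derivative g (at 0) v)) = (\<lambda>v. v)"
    by (rule has_derivative_unique)
  then show ?thesis
    by (rule fun_cong)
qed

text \<open>In the second differentiation both the base point and the direction vary. The expansion
  moves the varying direction into scalar coefficients and leaves derivatives in fixed directions,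
  to which \<open>second_derivative\<close> applies.\<close>

lemma frechet_derivative_axis_expansion:
  fixes g :: "real^3 \<Rightarrow> 'b::real_normed_vector"
  assumes "(g has_derivative frechet_derivative g (at y)) (at y)"
  shows "frechet_derivative g (at y) v = v$1 *\<^sub>R frechet_derivative g (at y) (axis 1 1)
    + v$2 *\<^sub>R frechet_derivative g (at y) (axis 2 1) + v$3 *\<^sub>R frechet_derivative g (at y) (axis 3 1)"
proof -
  have lin: "linear (frechet_derivative g (at y))"
    using assms has_derivative_linear by blast
  have "v = v$1 *\<^sub>R axis 1 1 + v$2 *\<^sub>R axis 2 1 + v$3 *\<^sub>R axis 3 1"
    by (simp add: vec_eq_iff forall_3 axis_def)
  then have "frechet_derivative g (at y) v = frechet_derivative g (at y)
      (v$1 *\<^sub>R axis 1 1 + v$2 *\<^sub>R axis 2 1 + v$3 *\<^sub>R axis 3 1)"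
    by (rule arg_cong)
  then show ?thesis
    by (simp only: linear_add[OF lin] linear_scale[OF lin])
qed

section \<open>The normal form and the jet it induces\<close>

abbreviation umbrella :: "real^2 \<Rightarrow> real^3" where
  "umbrella w \<equiv> vector [w$1, (w$2)\<^sup>2, w$1 * w$2]"

lemma vector_3_axis: "vector [a, b, c] = a *\<^sub>R axis 1 1 + b *\<^sub>R axis 2 1 + c *\<^sub>R (axis 3 1 :: real^3)"
  by (simp add: vec_eq_iff forall_3 axis_def)

lemma has_derivative_vec_nth:
  "(g has_derivative g') F \<Longrightarrow> ((\<lambda>x. g x $ i) has_derivative (\<lambda>h. g' h $ i)) F"
  by (rule bounded_linear.has_derivative[OF bounded_linear_vec_nth])

lemma has_derivative_umbrella:
  assumes "(g has_derivative g') (at x)"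
  shows "((\<lambda>x. umbrella (g x)) has_derivative
    (\<lambda>h. vector [g' h $ 1, 2 * g x $ 2 * g' h $ 2, g x $ 1 * g' h $ 2 + g x $ 2 * g' h $ 1])) (at x)"
proof -
  note d = has_derivative_vec_nth[OF assms]
  note sum = has_derivative_add[OF has_derivative_add[OF
        has_derivative_scaleR_left[OF d[of 1]]
        has_derivative_scaleR_left[OF has_derivative_power[OF d[of 2], of 2]]]
      has_derivative_scaleR_left[OF has_derivative_mult[OF d[of 1] d[of 2]]]]
  show ?thesis
    unfolding vector_3_axis
    by (rule has_derivative_eq_rhs[OF sum]) (simp add: fun_eq_iff mult.commute mult.left_commute)
qed

text \<open>Substituting \<open>lam x\<close> for \<open>w\<close> in the normal form and applying
  \<open>mu'\<close> solves for \<open>f\<close>. The eventual identities can be composed because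
  the germs tend to 0 at 0.\<close>

lemma whitney_umbrella_factorization:
  assumes "whitney_umbrella f"
  obtains lam lam' mu mu' where "diffeo_germ_pair lam lam'" "diffeo_germ_pair mu mu'"
    "\<forall>\<^sub>F x in nhds 0. f x = mu' (umbrella (lam x))"
proof -
  obtain lam lam' mu mu' where l: "diffeo_germ_pair lam lam'" and m: "diffeo_germ_pair mu mu'"
    and e: "\<forall>\<^sub>F w in nhds 0. mu (f (lam' w)) = umbrella w" and f: "smooth_germ f"
    using assms unfolding whitney_umbrella_def by blast
  have "\<forall>\<^sub>F x in nhds 0. mu (f (lam' (lam x))) = umbrella (lam x)"
    using l smooth_germ_continuous_at_0
    unfolding diffeo_germ_pair_def by (blast intro: eventually_compose_filterlim[OF e])
  moreover have "\<forall>\<^sub>F x in nhds 0. lam' (lam x) = x"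
    using l unfolding diffeo_germ_pair_def by blast
  moreover have "\<forall>\<^sub>F x in nhds 0. mu' (mu (f x)) = f x"
  proof (rule eventually_compose_filterlim[OF _ smooth_germ_continuous_at_0[OF f]])
    show "\<forall>\<^sub>F y in nhds 0. mu' (mu y) = y"
      using m unfolding diffeo_germ_pair_def by blast
  qed
  ultimately have "\<forall>\<^sub>F x in nhds 0. f x = mu' (umbrella (lam x))"
  proof eventually_elim
    case (elim x)
    have "mu (f x) = umbrella (lam x)"
      using elim(1) unfolding elim(2) .
    with elim(3) show ?case by simp
  qed
  with l m show ?thesis by (rule that)
qed

text \<open>The first derivative is computed at all points near 0 and then differentiated at 0.
  Since \<open>lam 0 = 0\<close>, the coefficients of \<open>e 2\<close> and \<open>e 3\<close> in
  the first derivative vanish there, so of the three varying axis derivatives of \<open>mu\<close>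
  only the first contributes a second derivative of \<open>mu\<close>.\<close>

lemma umbrella_composition_jet:
  assumes lam: "smooth_germ lam" and mu: "smooth_germ mu"
    and f: "\<forall>\<^sub>F x in nhds 0. f x = mu (umbrella (lam x))"
  defines "L \<equiv> frechet_derivative lam (at 0)"
    and "e \<equiv> \<lambda>i. frechet_derivative mu (at 0) (axis i 1)"
  shows "frechet_derivative f (at 0) X = L X $ 1 *\<^sub>R e 1"
    and "second_derivative f 0 X Y = second_derivative lam 0 X Y $ 1 *\<^sub>R e 1
      + L X $ 1 *\<^sub>R second_derivative mu 0 (axis 1 1) (L Y $ 1 *\<^sub>R axis 1 1)
      + (2 * L X $ 2 * L Y $ 2) *\<^sub>R e 2 + (L X $ 2 * L Y $ 1 + L X $ 1 * L Y $ 2) *\<^sub>R e 3"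
proof -
  obtain U where U: "open U" "0 \<in> U" "smooth_on lam U"
    using lam unfolding smooth_germ_def by blast
  obtain V where V: "open V" "0 \<in> V" "smooth_on mu V"
    using mu unfolding smooth_germ_def by blast
  have lam0: "lam 0 = 0" and mu0: "mu 0 = 0"
    using lam mu unfolding smooth_germ_def by auto
  have umb0: "umbrella 0 = 0" "vector [0, 0, 0] = (0::real^3)" by (simp_all add: vec_eq_iff forall_3)
  have dlam: "(lam has_derivative L) (at 0)"
    unfolding L_def using U by (intro smooth_on_has_derivative)
  have "isCont (\<lambda>x. umbrella (lam x)) 0"
    using has_derivative_umbrella[OF dlam] by (rule has_derivative_continuous)
  then have "((\<lambda>x. umbrella (lam x)) \<longlongrightarrow> umbrella (lam 0)) (nhds 0)"
    by (rule isCont_tendsto_nhds)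
  then have "((\<lambda>x. umbrella (lam x)) \<longlongrightarrow> 0) (nhds 0)"
    by (simp only: lam0 umb0(1))
  then have "\<forall>\<^sub>F x in nhds 0. umbrella (lam x) \<in> V"
    using V(1,2) by (rule topological_tendstoD)
  moreover have "\<forall>\<^sub>F x in nhds 0. x \<in> U"
    using U by (intro eventually_nhds_in_open)
  ultimately have "\<forall>\<^sub>F x in nhds 0. f x = mu (umbrella (lam x)) \<and> umbrella (lam x) \<in> V \<and> x \<in> U"
    using f by eventually_elim blast
  then obtain N where N: "open N" "0 \<in> N"
    "\<And>x. x \<in> N \<Longrightarrow> f x = mu (umbrella (lam x)) \<and> umbrella (lam x) \<in> V \<and> x \<in> U"
    unfolding eventually_nhds by blast
  let ?dl = "\<lambda>x. frechet_derivative lam (at x)"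
  let ?e = "\<lambda>i x. frechet_derivative mu (at (umbrella (lam x))) (axis i 1)"
  let ?F = "\<lambda>X x. ?dl x X $ 1 *\<^sub>R ?e 1 x + (2 * lam x $ 2 * ?dl x X $ 2) *\<^sub>R ?e 2 x
    + (lam x $ 1 * ?dl x X $ 2 + lam x $ 2 * ?dl x X $ 1) *\<^sub>R ?e 3 x"
  have df: "?F X x = frechet_derivative f (at x) X" if x: "x \<in> N" for x X
  proof -
    have l: "(lam has_derivative ?dl x) (at x)"
      using U N(3)[OF x] by (intro smooth_on_has_derivative) auto
    have m: "(mu has_derivative frechet_derivative mu (at (umbrella (lam x)))) (at (umbrella (lam x)))"
      using V N(3)[OF x] by (intro smooth_on_has_derivative) auto
    have fd: "(f has_derivative (\<lambda>h. frechet_derivative mu (at (umbrella (lam x)))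
       (vector [?dl x h $ 1, 2 * lam x $ 2 * ?dl x h $ 2, lam x $ 1 * ?dl x h $ 2 + lam x $ 2 * ?dl x h $ 1]))) (at x)"
      using has_derivative_transform_within_open[OF
          has_derivative_compose[OF has_derivative_umbrella[OF l] m] N(1) x] N(3)
      by auto
    have "frechet_derivative f (at x) X = frechet_derivative mu (at (umbrella (lam x)))
       (vector [?dl x X $ 1, 2 * lam x $ 2 * ?dl x X $ 2, lam x $ 1 * ?dl x X $ 2 + lam x $ 2 * ?dl x X $ 1])"
      by (rule fun_cong[OF frechet_derivative_at[OF fd, symmetric]])
    also have "\<dots> = ?F X x"
      by (rule trans[OF frechet_derivative_axis_expansion[OF m]]) (simp only: vector_3)
    finally show ?thesis
      by (rule sym)
  qed
  show "frechet_derivative f (at 0) X = L X $ 1 *\<^sub>R e 1"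
    using df[OF N(2), of X] by (simp add: lam0 umb0 L_def e_def)
  have l2: "((\<lambda>x. ?dl x X) has_derivative second_derivative lam 0 X) (at 0)" for X
    using U by (intro smooth_on_has_second_derivative)
  \<comment> \<open>The quadratic components of the umbrella have zero derivative at 0, so the base
    point of the derivative of \<open>mu\<close> moves to first order only along the first
    axis.\<close>
  have umb: "((\<lambda>x. umbrella (lam x)) has_derivative (\<lambda>h. L h $ 1 *\<^sub>R axis 1 1)) (at 0)"
    using has_derivative_umbrella[OF dlam] by (simp add: lam0 vector_3_axis)
  have "((\<lambda>y. frechet_derivative mu (at y) v) has_derivative second_derivative mu 0 v)
      (at (umbrella (lam 0)))" for v
    using V by (simp add: lam0 umb0 smooth_on_has_second_derivative)
  note e = has_derivative_compose[OF umb this]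
  have "(?F X has_derivative (\<lambda>Y. second_derivative lam 0 X Y $ 1 *\<^sub>R e 1
      + L X $ 1 *\<^sub>R second_derivative mu 0 (axis 1 1) (L Y $ 1 *\<^sub>R axis 1 1)
      + (2 * L X $ 2 * L Y $ 2) *\<^sub>R e 2 + (L X $ 2 * L Y $ 1 + L X $ 1 * L Y $ 2) *\<^sub>R e 3)) (at 0)"
    by (rule derivative_eq_intros has_derivative_vec_nth[OF dlam] has_derivative_vec_nth[OF l2] e refl)+
      (simp add: fun_eq_iff lam0 umb0 L_def e_def algebra_simps)
  from has_derivative_transform_within_open[OF this N(1,2) df]
  show "second_derivative f 0 X Y = second_derivative lam 0 X Y $ 1 *\<^sub>R e 1
      + L X $ 1 *\<^sub>R second_derivative mu 0 (axis 1 1) (L Y $ 1 *\<^sub>R axis 1 1)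
      + (2 * L X $ 2 * L Y $ 2) *\<^sub>R e 2 + (L X $ 2 * L Y $ 1 + L X $ 1 * L Y $ 2) *\<^sub>R e 3"
    unfolding second_derivative_def[of f] by (subst frechet_derivative_at[symmetric]) auto
qed

text \<open>In the frame \<open>e 1\<close>, \<open>e 2\<close>, \<open>e 3\<close> given by the
  derivative of \<open>mu'\<close>, modulo \<open>e 1\<close> the vectors \<open>B X k\<close> and
  \<open>B k k\<close> are nonzero multiples of \<open>e 3\<close> and \<open>e 2\<close>, coming
  from the terms \<open>uv\<close> and \<open>v^2\<close> of the normal form.\<close>

lemma whitney_umbrella_jet:
  assumes "whitney_umbrella f"
  obtains k X where "frechet_derivative f (at 0) k = 0"
    and "norm (frechet_derivative f (at 0) X) = 1"
    and "\<forall>\<alpha> \<beta> \<delta>. \<alpha> *\<^sub>R frechet_derivative f (at 0) X + \<beta> *\<^sub>R second_derivative f 0 X k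
      + \<delta> *\<^sub>R second_derivative f 0 k k = 0 \<longrightarrow> \<alpha> = 0 \<and> \<beta> = 0 \<and> \<delta> = 0"
proof -
  obtain lam lam' mu mu' where l: "diffeo_germ_pair lam lam'" and m: "diffeo_germ_pair mu mu'"
    and f: "\<forall>\<^sub>F x in nhds 0. f x = mu' (umbrella (lam x))"
    using whitney_umbrella_factorization[OF assms] by blast
  let ?L = "frechet_derivative lam (at 0)"
  let ?M = "frechet_derivative mu' (at 0)"
  define e where "e = (\<lambda>i. ?M (axis i 1))"
  have germs: "smooth_germ lam" "smooth_germ mu'"
    using l m unfolding diffeo_germ_pair_def by auto
  have linM: "linear ?M"
    using smooth_germ_has_derivative[OF germs(2)] has_derivative_linear by blast
  have linL: "linear ?L"
    using smooth_germ_has_derivative[OF germs(1)] has_derivative_linear by blast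
  note jet = umbrella_composition_jet[OF germs f]
  \<comment> \<open>The vectors \<open>e i\<close> are the images of the standard basis under the
    derivative of \<open>mu'\<close>, which the derivative of \<open>mu\<close> inverts.\<close>
  have indep: "a = 0 \<and> b = 0 \<and> c = 0" if "a *\<^sub>R e 1 + b *\<^sub>R e 2 + c *\<^sub>R e 3 = 0" for a b c
  proof -
    have "?M (vector [a, b, c]) = 0"
      using that by (simp only: vector_3_axis linear_add[OF linM] linear_scale[OF linM] e_def)
    then have "vector [a, b, c] = frechet_derivative mu (at 0) 0"
      using diffeo_germ_pair_derivative_left_inverse[OF diffeo_germ_pair_sym[OF m]] by metis
    also have "\<dots> = 0"
      using m smooth_germ_has_derivative has_derivative_linear linear_0
      unfolding diffeo_germ_pair_def by metis
    finally show ?thesis by (simp add: vec_eq_iff forall_3)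
  qed
  have e1: "e 1 \<noteq> 0" using indep[of 1 0 0] by auto
  define r where "r = inverse (norm (e 1))"
  have r: "r > 0" "r * norm (e 1) = 1" using e1 by (auto simp: r_def)
  \<comment> \<open>\<open>X\<close> and \<open>k\<close> are the coordinate directions of the
    normal form pulled back by \<open>lam\<close>; the factor \<open>r\<close> makes the image of
    \<open>X\<close> a unit vector.\<close>
  define X where "X = r *\<^sub>R frechet_derivative lam' (at 0) (axis 1 1)"
  define k where "k = frechet_derivative lam' (at 0) (axis 2 1)"
  have LX: "?L X = r *\<^sub>R axis 1 1" and Lk: "?L k = axis 2 1"
    using diffeo_germ_pair_derivative_left_inverse[OF diffeo_germ_pair_sym[OF l]]
    by (auto simp: X_def k_def linear_scale[OF linL])
  have X1: "?L X $ 1 = r" "?L X $ 2 = 0" "?L k $ 1 = 0" "?L k $ 2 = 1"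
    by (auto simp: LX Lk axis_def)
  have "linear (second_derivative mu' 0 (axis 1 1))"
    using germs(2) second_derivative_linear_right unfolding smooth_germ_def by blast
  then have z: "second_derivative mu' 0 (axis 1 1) 0 = 0" by (rule linear_0)
  show ?thesis
  proof (intro that allI impI)
    show "frechet_derivative f (at 0) k = 0" by (simp add: jet X1)
    show "norm (frechet_derivative f (at 0) X) = 1"
      using r by (simp add: jet X1 e_def)
    fix \<alpha> \<beta> \<delta>
    assume "\<alpha> *\<^sub>R frechet_derivative f (at 0) X + \<beta> *\<^sub>R second_derivative f 0 X k
      + \<delta> *\<^sub>R second_derivative f 0 k k = 0"
    then have "(\<alpha> * r + \<beta> * second_derivative lam 0 X k $ 1 + \<delta> * second_derivative lam 0 k k $ 1) *\<^sub>R e 1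
      + (2 * \<delta>) *\<^sub>R e 2 + (\<beta> * r) *\<^sub>R e 3 = 0"
      by (simp add: jet X1 z e_def algebra_simps)
    from indep[OF this] r(1) show "\<alpha> = 0 \<and> \<beta> = 0 \<and> \<delta> = 0" by auto
  qed
qed

section \<open>The curvature parabola and the focal conic\<close>

lemma independent_triple_orthogonal_imp_zero:
  fixes a b c x :: "real^3"
  assumes indep: "\<And>\<alpha> \<beta> \<delta>. \<alpha> *\<^sub>R a + \<beta> *\<^sub>R b + \<delta> *\<^sub>R c = 0 \<Longrightarrow> \<alpha> = 0 \<and> \<beta> = 0 \<and> \<delta> = 0"
    and x: "x \<bullet> a = 0" "x \<bullet> b = 0" "x \<bullet> c = 0"
  shows "x = 0"
proof -
  define g where "g = (\<lambda>y::real^3. y$1 *\<^sub>R a + y$2 *\<^sub>R b + y$3 *\<^sub>R c)"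
  have lin: "linear g"
    unfolding g_def by (rule linearI) (simp_all add: algebra_simps)
  moreover have "inj g"
    unfolding linear_injective_0[OF lin]
  proof (intro allI impI)
    fix y assume "g y = 0"
    from indep[OF this[unfolded g_def]] show "y = 0" by (simp add: vec_eq_iff forall_3)
  qed
  \<comment> \<open>Three independent vectors span the space, so \<open>x\<close> is a combination
    of vectors orthogonal to it.\<close>
  ultimately have "surj g"
    by (rule linear_inj_imp_surj)
  then obtain y where y: "x = g y"
    unfolding surj_def by blast
  have "x \<bullet> g y = 0"
    by (simp add: g_def inner_add_right x)
  then have "x \<bullet> x = 0" by (simp only: y[symmetric])
  then show ?thesis by simp
qed

lemma orthogonal_triple_orthogonal_imp_zero:
  fixes a b c x :: "real^3"
  assumes "a \<noteq> 0" "b \<noteq> 0" "c \<noteq> 0" and o: "a \<bullet> b = 0" "a \<bullet> c = 0" "b \<bullet> c = 0"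
    and x: "x \<bullet> a = 0" "x \<bullet> b = 0" "x \<bullet> c = 0"
  shows "x = 0"
proof (rule independent_triple_orthogonal_imp_zero[OF _ x])
  fix \<alpha> \<beta> \<delta>
  assume z: "\<alpha> *\<^sub>R a + \<beta> *\<^sub>R b + \<delta> *\<^sub>R c = 0"
  have "a \<bullet> (\<alpha> *\<^sub>R a + \<beta> *\<^sub>R b + \<delta> *\<^sub>R c) = \<alpha> * (a \<bullet> a)"
    "b \<bullet> (\<alpha> *\<^sub>R a + \<beta> *\<^sub>R b + \<delta> *\<^sub>R c) = \<beta> * (b \<bullet> b)"
    "c \<bullet> (\<alpha> *\<^sub>R a + \<beta> *\<^sub>R b + \<delta> *\<^sub>R c) = \<delta> * (c \<bullet> c)"
    using o by (simp_all add: inner_add_right inner_commute[of b a] inner_commute[of c a] inner_commute[of c b])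
  then show "\<alpha> = 0 \<and> \<beta> = 0 \<and> \<delta> = 0"
    unfolding z using assms by simp
qed

lemma vec2_axis_expansion: "v = v$1 *\<^sub>R axis 1 1 + v$2 *\<^sub>R axis 2 (1::real)" for v :: "real^2"
  by (simp add: vec_eq_iff forall_2 axis_def)

text \<open>The data of \<open>f\<close> at 0 from which both the parabola and the focal conic are
  computed. The vector \<open>k\<close> spans the kernel of the derivative, and \<open>A X\<close>
  is a unit tangent vector.\<close>

locale corank_one_jet =
  fixes f :: "real^2 \<Rightarrow> real^3" and U :: "(real^2) set" and X k :: "real^2"
  assumes open_U: "open U" and zero_mem: "0 \<in> U" and smooth: "smooth_on f U" and f0: "f 0 = 0"
    and kernel: "frechet_derivative f (at 0) k = 0"
    and unit: "norm (frechet_derivative f (at 0) X) = 1"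
    and indep: "\<alpha> *\<^sub>R frechet_derivative f (at 0) X + \<beta> *\<^sub>R second_derivative f 0 X k
      + \<delta> *\<^sub>R second_derivative f 0 k k = 0 \<Longrightarrow> \<alpha> = 0 \<and> \<beta> = 0 \<and> \<delta> = 0"
begin

abbreviation A where "A \<equiv> frechet_derivative f (at 0)"
abbreviation B where "B \<equiv> second_derivative f 0"
abbreviation n where "n \<equiv> A X"

definition proj :: "real^3 \<Rightarrow> real^3" where
  "proj y = y - (y \<bullet> n) *\<^sub>R n"

definition p where "p = proj (B X X)"
definition q where "q = proj (B X k)"
definition r where "r = proj (B k k)"

definition parabola :: "real \<Rightarrow> real^3" where
  "parabola s = p + (2 * s) *\<^sub>R q + s\<^sup>2 *\<^sub>R r"

text \<open>The foot of the perpendicular from 0 to the tangent line at parameter \<open>s\<close>;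
  the direction \<open>q + s r\<close> is half the velocity of \<open>parabola\<close>.\<close>

definition foot :: "real \<Rightarrow> real^3" where
  "foot s = parabola s - (((q + s *\<^sub>R r) \<bullet> parabola s) / ((q + s *\<^sub>R r) \<bullet> (q + s *\<^sub>R r))) *\<^sub>R (q + s *\<^sub>R r)"

lemma linear_A: "linear A"
  using smooth_on_has_derivative[OF smooth zero_mem] has_derivative_linear by blast

lemma linear_B_right: "linear (B Y)"
  using second_derivative_linear_right[OF smooth zero_mem] .

lemma linear_B_left: "linear (\<lambda>Y. B Y Z)"
  using second_derivative_linear_left[OF smooth open_U zero_mem] .

lemma B_commute: "B Y Z = B Z Y"
  using second_derivative_commute[OF smooth open_U zero_mem] .

lemmas A_linear = linear_add[OF linear_A] linear_scale[OF linear_A]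
lemmas B_linear = linear_add[OF linear_B_right] linear_scale[OF linear_B_right]
  linear_add[OF linear_B_left] linear_scale[OF linear_B_left]

lemma linear_proj: "linear proj"
  unfolding proj_def by (rule linearI) (simp_all add: algebra_simps)

lemma n_inner_n: "n \<bullet> n = 1"
  using unit by (simp add: norm_eq_sqrt_inner)

lemma proj_orthogonal: "proj y \<bullet> n = 0"
  by (simp add: proj_def inner_diff_left n_inner_n)

lemma inner_proj: "x \<bullet> n = 0 \<Longrightarrow> x \<bullet> proj y = x \<bullet> y"
  by (simp add: proj_def inner_diff_right)

text \<open>If \<open>X\<close> and \<open>k\<close> were parallel, then \<open>A k = 0\<close> and
  \<open>A X \<noteq> 0\<close> would force \<open>k = 0\<close>, hence \<open>B k k = 0\<close>,
  against independence.\<close>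

lemma basis_det_nonzero: "X$1 * k$2 - X$2 * k$1 \<noteq> 0"
proof
  assume d: "X$1 * k$2 - X$2 * k$1 = 0"
  have n0: "n \<noteq> 0" using unit by auto
  have "k$1 *\<^sub>R X = X$1 *\<^sub>R k" "k$2 *\<^sub>R X = X$2 *\<^sub>R k"
    using d by (simp_all add: vec_eq_iff forall_2 mult.commute)
  then have "k$1 *\<^sub>R n = 0" "k$2 *\<^sub>R n = 0"
    using kernel by (simp_all flip: linear_scale[OF linear_A])
      (simp_all add: linear_scale[OF linear_A])
  with n0 have "k$1 = 0" "k$2 = 0" by simp_all
  then have "k = 0" by (simp add: vec_eq_iff forall_2)
  then have "B k k = 0" using linear_0[OF linear_B_right] by simp
  then show False using indep[of 0 0 1] by simp
qed

lemma decompose: obtains s t where "Y = s *\<^sub>R X + t *\<^sub>R k"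
proof -
  let ?d = "X$1 * k$2 - X$2 * k$1"
  \<comment> \<open>Cramer's rule.\<close>
  have "?d *\<^sub>R Y = (Y$1 * k$2 - Y$2 * k$1) *\<^sub>R X + (X$1 * Y$2 - X$2 * Y$1) *\<^sub>R k"
    by (simp add: vec_eq_iff forall_2 algebra_simps)
  then have "(1 / ?d) *\<^sub>R (?d *\<^sub>R Y) = ((Y$1 * k$2 - Y$2 * k$1) / ?d) *\<^sub>R X + ((X$1 * Y$2 - X$2 * Y$1) / ?d) *\<^sub>R k"
    by (simp only: scaleR_add_right scaleR_scaleR) simp
  then show ?thesis
    using that basis_det_nonzero by simp
qed

lemma A_combination: "A (s *\<^sub>R X + t *\<^sub>R k) = s *\<^sub>R n"
  by (simp only: A_linear kernel scaleR_zero_right add_0_right)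

section \<open>The normal plane and the curvature parabola\<close>

lemma tangent_line_eq: "tangent_line f = range (\<lambda>s. s *\<^sub>R n)"
proof -
  have "A Y \<in> range (\<lambda>s. s *\<^sub>R n)" for Y
  proof -
    obtain s t where "Y = s *\<^sub>R X + t *\<^sub>R k" by (rule decompose)
    then have "A Y = s *\<^sub>R n" by (simp only: A_combination)
    then show ?thesis by (rule range_eqI)
  qed
  moreover have "s *\<^sub>R n \<in> range A" for s
    by (rule range_eqI[of _ _ "s *\<^sub>R X"]) (simp only: A_linear)
  ultimately show ?thesis
    unfolding tangent_line_def by (intro equalityI image_subsetI)
qed

lemma normal_plane_eq: "normal_plane f = {x. x \<bullet> n = 0}"
  unfolding normal_plane_def tangent_line_eq orthogonal_comp_def
  by (auto simp: orthogonal_def inner_commute)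

lemma normal_proj_eq: "normal_proj f y = proj y"
  unfolding normal_proj_def
proof (rule the_equality)
  have "y - proj y = (y \<bullet> n) *\<^sub>R n" by (simp add: proj_def)
  then show "proj y \<in> normal_plane f \<and> y - proj y \<in> tangent_line f"
    unfolding normal_plane_eq tangent_line_eq using proj_orthogonal by blast
next
  fix z assume z: "z \<in> normal_plane f \<and> y - z \<in> tangent_line f"
  then obtain s where "y - z = s *\<^sub>R n" and n: "z \<bullet> n = 0"
    unfolding normal_plane_eq tangent_line_eq by blast
  then have y: "y = z + s *\<^sub>R n" by (simp add: diff_eq_eq add.commute)
  show "z = proj y"
    unfolding proj_def y by (simp add: inner_add_left n_inner_n n)
qed

lemma pderivative_0: "pderivative i f 0 = A (axis i 1)"
  by (simp add: pderivative_def)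

lemma pderivative_pderivative_0: "pderivative i (pderivative j f) 0 = B (axis j 1) (axis i 1)"
  by (simp add: pderivative_def[abs_def] second_derivative_def)

lemma first_form_eq: "first_form f a b = (let v = a *\<^sub>R axis 1 1 + b *\<^sub>R axis 2 1 in A v \<bullet> A v)"
  by (simp add: first_form_def Let_def pderivative_0 A_linear inner_simps power2_eq_square
      inner_commute algebra_simps)

lemma second_form_eq: "second_form f a b = (let v = a *\<^sub>R axis 1 1 + b *\<^sub>R axis 2 1 in proj (B v v))"
proof -
  have "a\<^sup>2 *\<^sub>R B (axis 1 1) (axis 1 1) + (2 * a * b) *\<^sub>R B (axis 1 1) (axis 2 1) + b\<^sup>2 *\<^sub>R B (axis 2 1) (axis 2 1)
    = B (a *\<^sub>R axis 1 1 + b *\<^sub>R axis 2 1) (a *\<^sub>R axis 1 1 + b *\<^sub>R axis 2 1)"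
    by (simp add: B_linear B_commute[of "axis 2 1" "axis 1 1"] vec_eq_iff power2_eq_square algebra_simps)
  then show ?thesis
    by (simp add: second_form_def Let_def pderivative_pderivative_0 normal_proj_eq)
qed

text \<open>A coordinate-free form, which allows the basis \<open>X\<close>, \<open>k\<close> to
  replace the coordinate axes.\<close>

lemma curvature_parabola_eq_forms: "curvature_parabola f = {proj (B v v) | v. A v \<bullet> A v = 1}"
proof -
  have "curvature_parabola f = {let v = a *\<^sub>R axis 1 1 + b *\<^sub>R axis 2 1 in proj (B v v) |a b.
      (let v = a *\<^sub>R axis 1 1 + b *\<^sub>R axis 2 1 in A v \<bullet> A v) = 1}"
    unfolding curvature_parabola_def first_form_eq second_form_eq ..
  also have "\<dots> = {proj (B v v) | v. A v \<bullet> A v = 1}"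
    unfolding Let_def by (auto, metis vec2_axis_expansion)
  finally show ?thesis .
qed

text \<open>Opposite vectors give the same point, so the sign \<open>s\<close> is absorbed into the
  parameter \<open>s * t\<close>, using \<open>t^2 = (s * t)^2\<close>.\<close>

lemma proj_second_form_combination:
  assumes "s\<^sup>2 = 1"
  shows "proj (B (s *\<^sub>R X + t *\<^sub>R k) (s *\<^sub>R X + t *\<^sub>R k)) = parabola (s * t)"
proof -
  have "B (s *\<^sub>R X + t *\<^sub>R k) (s *\<^sub>R X + t *\<^sub>R k)
      = s\<^sup>2 *\<^sub>R B X X + (2 * (s * t)) *\<^sub>R B X k + t\<^sup>2 *\<^sub>R B k k"
    by (simp add: B_linear B_commute[of k X] vec_eq_iff power2_eq_square algebra_simps)
  moreover have "t\<^sup>2 = (s * t)\<^sup>2" using assms by (simp add: power_mult_distrib)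
  ultimately show ?thesis
    using assms
    by (simp add: linear_add[OF linear_proj] linear_scale[OF linear_proj] parabola_def p_def q_def r_def)
qed

lemma curvature_parabola_eq: "curvature_parabola f = range parabola"
proof (intro set_eqI iffI)
  fix y assume "y \<in> curvature_parabola f"
  then obtain v where v: "y = proj (B v v)" "A v \<bullet> A v = 1"
    unfolding curvature_parabola_eq_forms by blast
  obtain s t where st: "v = s *\<^sub>R X + t *\<^sub>R k" by (rule decompose)
  then have "s\<^sup>2 = 1" using v by (simp add: A_combination n_inner_n power2_eq_square)
  then show "y \<in> range parabola"
    using proj_second_form_combination v st by blast
next
  fix y assume "y \<in> range parabola"
  then obtain t where "y = parabola (1 * t)" by auto
  then have "y = proj (B (1 *\<^sub>R X + t *\<^sub>R k) (1 *\<^sub>R X + t *\<^sub>R k))"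
    using proj_second_form_combination[of 1 t] by simp
  moreover have "A (1 *\<^sub>R X + t *\<^sub>R k) \<bullet> A (1 *\<^sub>R X + t *\<^sub>R k) = 1"
    unfolding A_combination by (simp add: n_inner_n)
  ultimately show "y \<in> curvature_parabola f"
    unfolding curvature_parabola_eq_forms by blast
qed

section \<open>The distance squared function and the equation of the focal conic\<close>

lemma has_derivative_distance_squared:
  assumes "w \<in> U"
  shows "((\<lambda>w. (norm (f w - x))\<^sup>2) has_derivative (\<lambda>h. 2 * ((f w - x) \<bullet> frechet_derivative f (at w) h))) (at w)"
proof -
  note D = has_derivative_diff[OF smooth_on_has_derivative[OF smooth assms] has_derivative_const[of x]]
  show ?thesis
    unfolding power2_norm_eq_inner
    by (rule has_derivative_eq_rhs[OF has_derivative_inner[OF D D]]) (simp add: fun_eq_iff inner_commute)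
qed

lemma hessian_distance_squared:
  "pderivative i (pderivative j (\<lambda>w. (norm (f w - x))\<^sup>2)) 0
    = 2 * (A (axis i 1) \<bullet> A (axis j 1) - x \<bullet> B (axis j 1) (axis i 1))"
proof -
  let ?g = "\<lambda>w. (norm (f w - x))\<^sup>2"
  have 1: "2 * ((f w - x) \<bullet> frechet_derivative f (at w) (axis j 1)) = pderivative j ?g w" if "w \<in> U" for w
    unfolding pderivative_def frechet_derivative_at[OF has_derivative_distance_squared[OF that], symmetric] ..
  note D = has_derivative_diff[OF smooth_on_has_derivative[OF smooth zero_mem] has_derivative_const[of x]]
  have "((\<lambda>w. 2 * ((f w - x) \<bullet> frechet_derivative f (at w) (axis j 1))) has_derivative
     (\<lambda>h. 2 * (A h \<bullet> A (axis j 1) - x \<bullet> B (axis j 1) h))) (at 0)"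
    by (rule has_derivative_eq_rhs[OF has_derivative_mult_right[OF
          has_derivative_inner[OF D smooth_on_has_second_derivative[OF smooth zero_mem]]]])
      (simp add: fun_eq_iff f0)
  from has_derivative_transform_within_open[OF this open_U zero_mem 1]
  have H: "(pderivative j ?g has_derivative (\<lambda>h. 2 * (A h \<bullet> A (axis j 1) - x \<bullet> B (axis j 1) h))) (at 0)" .
  show ?thesis
    unfolding pderivative_def[of i] frechet_derivative_at[OF H, symmetric] ..
qed

lemma critical_point_iff:
  "((\<lambda>w. (norm (f w - x))\<^sup>2) has_derivative (\<lambda>_. 0)) (at 0) \<longleftrightarrow> x \<bullet> n = 0"
proof
  assume "((\<lambda>w. (norm (f w - x))\<^sup>2) has_derivative (\<lambda>_. 0)) (at 0)"
  from fun_cong[OF has_derivative_unique[OF this has_derivative_distance_squared[OF zero_mem]], of X]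
  show "x \<bullet> n = 0" by (simp add: f0)
next
  assume x: "x \<bullet> n = 0"
  have "x \<bullet> A h = 0" for h
  proof -
    obtain s t where h: "h = s *\<^sub>R X + t *\<^sub>R k" by (rule decompose)
    show ?thesis unfolding h A_combination inner_scaleR_right x by simp
  qed
  then show "((\<lambda>w. (norm (f w - x))\<^sup>2) has_derivative (\<lambda>_. 0)) (at 0)"
    using has_derivative_distance_squared[OF zero_mem, of x] by (simp add: f0)
qed

text \<open>Half the Hessian is the form \<open>H\<close>. Its determinants in the axis basis and in
  the basis \<open>X\<close>, \<open>k\<close> differ by the square of a nonzero change-of-basis
  determinant, and in the second basis \<open>A k = 0\<close> simplifies the entries.\<close>

lemma mem_focal_conic_iff:
  "x \<in> focal_conic f \<longleftrightarrow> x \<bullet> n = 0 \<and> (1 - x \<bullet> p) * (x \<bullet> r) + (x \<bullet> q)\<^sup>2 = 0"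
proof (cases "x \<bullet> n = 0")
  case True
  define H where "H Y Z = A Y \<bullet> A Z - x \<bullet> B Y Z" for Y Z
  have H_sym: "H Y Z = H Z Y" for Y Z
    unfolding H_def using B_commute by (simp add: inner_commute)
  define a b c where "a = H (axis 1 1) (axis 1 1)" "b = H (axis 1 1) (axis 2 1)"
    "c = H (axis 2 1) (axis 2 1)"
  note abc = this
  have bil: "H Y Z = Y$1 * Z$1 * a + (Y$1 * Z$2 + Y$2 * Z$1) * b + Y$2 * Z$2 * c" for Y Z
  proof -
    have "H Y Z = H (Y$1 *\<^sub>R axis 1 1 + Y$2 *\<^sub>R axis 2 1) (Z$1 *\<^sub>R axis 1 1 + Z$2 *\<^sub>R axis 2 1)"
      using vec2_axis_expansion[of Y] vec2_axis_expansion[of Z] by (rule arg_cong2)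
    also have "\<dots> = Y$1 * Z$1 * a + (Y$1 * Z$2 + Y$2 * Z$1) * b + Y$2 * Z$2 * c"
      unfolding abc H_def
      by (simp add: A_linear B_linear inner_simps B_commute[of "axis 2 1" "axis 1 1"]
          inner_commute[of "A (axis 2 1)" "A (axis 1 1)"] algebra_simps)
    finally show ?thesis .
  qed
  have "H X X * H k k - (H X k)\<^sup>2 = (X$1 * k$2 - X$2 * k$1)\<^sup>2 * (a * c - b\<^sup>2)"
    unfolding bil by algebra
  moreover have det: "det (\<chi> i j. pderivative i (pderivative j (\<lambda>w. (norm (f w - x))\<^sup>2)) 0) = 4 * (a * c - b\<^sup>2)"
    unfolding det_2 abc H_def vec_lambda_beta hessian_distance_squared
    by (simp add: B_commute[of "axis 2 1" "axis 1 1"]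
          inner_commute[of "A (axis 2 1)" "A (axis 1 1)"] power2_eq_square algebra_simps)
  \<comment> \<open>As \<open>x\<close> is normal, pairing with \<open>B\<close> equals pairing with
    its normal part.\<close>
  moreover have "H X X = 1 - x \<bullet> p" "H X k = - (x \<bullet> q)" "H k k = - (x \<bullet> r)"
    using True by (simp_all add: H_def p_def q_def r_def inner_proj n_inner_n kernel)
  ultimately have "(X$1 * k$2 - X$2 * k$1)\<^sup>2 * (a * c - b\<^sup>2) = - ((1 - x \<bullet> p) * (x \<bullet> r) + (x \<bullet> q)\<^sup>2)"
    by simp
  moreover have "(X$1 * k$2 - X$2 * k$1)\<^sup>2 * (a * c - b\<^sup>2) = 0 \<longleftrightarrow> a * c - b\<^sup>2 = 0"
    using basis_det_nonzero by simp
  ultimately have "det (\<chi> i j. pderivative i (pderivative j (\<lambda>w. (norm (f w - x))\<^sup>2)) 0) = 0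
      \<longleftrightarrow> (1 - x \<bullet> p) * (x \<bullet> r) + (x \<bullet> q)\<^sup>2 = 0"
    unfolding det by (metis mult_eq_0_iff neg_equal_0_iff_equal zero_neq_numeral)
  with True show ?thesis
    by (simp add: focal_conic_def degenerate_critical_point_def critical_point_iff)
qed (simp add: focal_conic_def degenerate_critical_point_def critical_point_iff)

section \<open>Duality between the focal conic and the tangent lines of the parabola\<close>

lemma proj_independent:
  assumes "\<alpha> *\<^sub>R n + \<beta> *\<^sub>R q + \<delta> *\<^sub>R r = 0"
  shows "\<alpha> = 0 \<and> \<beta> = 0 \<and> \<delta> = 0"
proof -
  \<comment> \<open>Projecting changes only the coefficient of \<open>n\<close>.\<close>
  have "(\<alpha> - \<beta> * (B X k \<bullet> n) - \<delta> * (B k k \<bullet> n)) *\<^sub>R n + \<beta> *\<^sub>R B X k + \<delta> *\<^sub>R B k k = 0"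
    using assms by (simp add: q_def r_def proj_def algebra_simps)
  from indep[OF this] show ?thesis by auto
qed

lemma tangent_nonzero: "q + s *\<^sub>R r \<noteq> 0"
  using proj_independent[of 0 1 s] by auto

lemma pqr_orthogonal: "p \<bullet> n = 0" "q \<bullet> n = 0" "r \<bullet> n = 0"
  by (simp_all add: p_def q_def r_def proj_orthogonal)

lemma foot_orthogonal: "foot s \<bullet> n = 0" "foot s \<bullet> (q + s *\<^sub>R r) = 0"
proof -
  show "foot s \<bullet> n = 0"
    by (simp add: foot_def parabola_def inner_add_left inner_diff_left pqr_orthogonal)
  have "(q + s *\<^sub>R r) \<bullet> (q + s *\<^sub>R r) \<noteq> 0"
    using tangent_nonzero by simp
  then show "foot s \<bullet> (q + s *\<^sub>R r) = 0"
    unfolding foot_def inner_diff_left inner_scaleR_left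
    by (simp only: inner_commute[of "parabola s"]) simp
qed

lemma inner_foot:
  assumes "x \<bullet> (q + s *\<^sub>R r) = 0"
  shows "x \<bullet> foot s = x \<bullet> parabola s"
  unfolding foot_def inner_diff_right inner_scaleR_right assms by simp

text \<open>The right-hand side says that the line of points \<open>y\<close> in the normal plane
  with \<open>x \<bullet> y = 1\<close> is tangent to the parabola at parameter \<open>s\<close>. At
  \<open>x = 0\<close> the null direction is \<open>k\<close>, which is no multiple of any
  \<open>X + s k\<close>, hence the exclusion.\<close>

lemma focal_iff_dual:
  assumes "x \<noteq> 0"
  shows "x \<in> focal_conic f \<longleftrightarrow>
    x \<bullet> n = 0 \<and> (\<exists>s. x \<bullet> (q + s *\<^sub>R r) = 0 \<and> x \<bullet> parabola s = 1)"
proof (intro iffI conjI; (elim conjE exE)?)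
  assume "x \<in> focal_conic f"
  then have x: "x \<bullet> n = 0" "(1 - x \<bullet> p) * (x \<bullet> r) + (x \<bullet> q)\<^sup>2 = 0"
    by (auto simp: mem_focal_conic_iff)
  then show "x \<bullet> n = 0" by simp
  have r0: "x \<bullet> r \<noteq> 0"
  proof
    assume "x \<bullet> r = 0"
    with x have "x \<bullet> q = 0" by simp
    with \<open>x \<bullet> r = 0\<close> x(1) assms show False
      using independent_triple_orthogonal_imp_zero[OF proj_independent] by blast
  qed
  \<comment> \<open>This choice makes \<open>X + s k\<close> a null vector of the degenerate Hessian
    form.\<close>
  define s where "s = - (x \<bullet> q) / (x \<bullet> r)"
  have s: "x \<bullet> q = - s * (x \<bullet> r)" using r0 by (simp add: s_def)
  have "(1 - x \<bullet> p + s\<^sup>2 * (x \<bullet> r)) * (x \<bullet> r) = 0"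
    using x(2) unfolding s by algebra
  with r0 have "1 - x \<bullet> p + s\<^sup>2 * (x \<bullet> r) = 0" by simp
  then have "x \<bullet> parabola s = 1"
    by (simp add: parabola_def inner_add_right s power2_eq_square)
  moreover have "x \<bullet> (q + s *\<^sub>R r) = 0" by (simp add: inner_add_right s)
  ultimately show "\<exists>s. x \<bullet> (q + s *\<^sub>R r) = 0 \<and> x \<bullet> parabola s = 1" by blast
next
  fix s assume x: "x \<bullet> n = 0" "x \<bullet> (q + s *\<^sub>R r) = 0" "x \<bullet> parabola s = 1"
  then have s: "x \<bullet> q = - s * (x \<bullet> r)" by (simp add: inner_add_right)
  have "x \<bullet> p = 1 + s\<^sup>2 * (x \<bullet> r)"
    using x(3) by (simp add: parabola_def inner_add_right s power2_eq_square)
  then show "x \<in> focal_conic f"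
    using x(1) unfolding mem_focal_conic_iff s by (simp add: power2_eq_square algebra_simps)
qed

text \<open>Inversion sends the foot of a line to its pole with respect to the unit circle:
  \<open>foot s\<close> is normal to the tangent line, and \<open>x \<bullet> foot s = 1\<close>
  fixes the length.\<close>

lemma inversion_foot_iff:
  assumes "x \<noteq> 0"
  shows "foot s \<noteq> 0 \<and> x = inversion (foot s) \<longleftrightarrow>
    x \<bullet> n = 0 \<and> x \<bullet> (q + s *\<^sub>R r) = 0 \<and> x \<bullet> parabola s = 1"
proof (intro iffI; elim conjE)
  assume f: "foot s \<noteq> 0" and x: "x = inversion (foot s)"
  have o: "x \<bullet> (q + s *\<^sub>R r) = 0"
    unfolding x inversion_def inner_scaleR_left foot_orthogonal by simp
  moreover have "x \<bullet> n = 0"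
    unfolding x inversion_def inner_scaleR_left foot_orthogonal by simp
  moreover have "x \<bullet> foot s = 1"
    using f unfolding x inversion_def by (simp add: power2_norm_eq_inner)
  ultimately show "x \<bullet> n = 0 \<and> x \<bullet> (q + s *\<^sub>R r) = 0 \<and> x \<bullet> parabola s = 1"
    using inner_foot by simp
next
  assume x: "x \<bullet> n = 0" "x \<bullet> (q + s *\<^sub>R r) = 0" "x \<bullet> parabola s = 1"
  let ?T = "q + s *\<^sub>R r"
  have 1: "x \<bullet> foot s = 1" using x inner_foot by simp
  define y where "y = foot s - (1 / (x \<bullet> x)) *\<^sub>R x"
  have T: "?T \<bullet> n = 0" by (simp add: inner_add_left pqr_orthogonal)
  \<comment> \<open>\<open>n\<close>, the tangent vector and \<open>x\<close> form an orthogonal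
    basis, and \<open>y\<close> is orthogonal to all three.\<close>
  have "y = 0"
  proof (rule orthogonal_triple_orthogonal_imp_zero[of n ?T x])
    show "n \<noteq> 0" "?T \<noteq> 0" "x \<noteq> 0"
      using unit tangent_nonzero assms by auto
    show "n \<bullet> ?T = 0" "n \<bullet> x = 0" "?T \<bullet> x = 0"
      using T x(1,2) inner_commute[of n ?T] inner_commute[of n x] inner_commute[of ?T x] by simp_all
    show "y \<bullet> n = 0" "y \<bullet> ?T = 0"
      unfolding y_def inner_diff_left inner_scaleR_left foot_orthogonal x by simp_all
    show "y \<bullet> x = 0"
      unfolding y_def inner_diff_left inner_scaleR_left inner_commute[of "foot s"] 1
      using assms by simp
  qed
  then have f: "foot s = (1 / (x \<bullet> x)) *\<^sub>R x" by (simp add: y_def)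
  moreover have "x \<bullet> x \<noteq> 0" using assms by simp
  ultimately show "foot s \<noteq> 0 \<and> x = inversion (foot s)"
    using assms unfolding inversion_def power2_norm_eq_inner by simp
qed

lemma inversion_image_range_foot: "inversion_image (range foot) = focal_conic f - {0}"
proof (intro set_eqI)
  fix x
  show "x \<in> inversion_image (range foot) \<longleftrightarrow> x \<in> focal_conic f - {0}"
  proof (cases "x = 0")
    case True
    then show ?thesis by (auto simp: inversion_image_def inversion_def)
  next
    case False
    have "x \<in> inversion_image (range foot) \<longleftrightarrow> (\<exists>s. foot s \<noteq> 0 \<and> x = inversion (foot s))"
      by (auto simp: inversion_image_def)
    then show ?thesis
      unfolding inversion_foot_iff[OF False] using focal_iff_dual[OF False] False by auto
  qed
qed

section \<open>Independence of the parametrization\<close>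

lemma parabola_parameter:
  obtains w where "\<And>s. (parabola s - p) \<bullet> w = s"
proof -
  \<comment> \<open>The component of \<open>q\<close> orthogonal to the axis direction
    \<open>r\<close>: pairing with it removes the quadratic term, so a linear functional recovers
    the parameter.\<close>
  define v where "v = q - ((q \<bullet> r) / (r \<bullet> r)) *\<^sub>R r"
  have r0: "r \<bullet> r \<noteq> 0" using proj_independent[of 0 0 1] by auto
  have v0: "v \<noteq> 0"
    using proj_independent[of 0 1 "- ((q \<bullet> r) / (r \<bullet> r))"] by (auto simp: v_def)
  have vr: "r \<bullet> v = 0" using r0 by (simp add: v_def inner_diff_right inner_commute)
  have "q = v + ((q \<bullet> r) / (r \<bullet> r)) *\<^sub>R r" by (simp add: v_def)
  then have "q \<bullet> v = v \<bullet> v" using vr by (metis add.right_neutral inner_add_left inner_scaleR_left mult_zero_right)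
  then have "(parabola s - p) \<bullet> ((1 / (2 * (v \<bullet> v))) *\<^sub>R v) = s" for s
    using v0 vr by (simp add: parabola_def inner_add_left)
  then show ?thesis by (rule that)
qed

text \<open>Any regular parametrization is \<open>parabola\<close> composed with a differentiable
  surjection \<open>\<tau>\<close> onto the reals, and the pedal formula is unchanged when the
  tangent vector is rescaled.\<close>

lemma range_pedal_curve:
  assumes \<gamma>: "regular_parametrization \<gamma> (curvature_parabola f)" and e: "tangent_field \<gamma> e"
  shows "range (pedal_curve \<gamma> e 0) = range foot"
proof -
  obtain w where w: "\<And>s. (parabola s - p) \<bullet> w = s"
    using parabola_parameter by blast
  define \<tau> where "\<tau> t = (\<gamma> t - p) \<bullet> w" for t
  have range: "range \<gamma> = range parabola"
    using \<gamma> by (simp add: regular_parametrization_def curvature_parabola_eq)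
  have \<gamma>_eq: "\<gamma> t = parabola (\<tau> t)" for t
  proof -
    obtain s where "\<gamma> t = parabola s" using range by blast
    then show ?thesis using w[of s] by (simp add: \<tau>_def)
  qed
  have pedal: "pedal_curve \<gamma> e 0 t = foot (\<tau> t)" for t
  proof -
    let ?T = "q + \<tau> t *\<^sub>R r"
    have d: "(\<gamma> has_vector_derivative vector_derivative \<gamma> (at t)) (at t)"
    proof -
      have "smooth_on \<gamma> UNIV"
        using \<gamma> unfolding regular_parametrization_def by blast
      then show ?thesis
        unfolding vector_derivative_works[symmetric]
        by (rule differentiableI[OF smooth_on_has_derivative]) simp
    qed
    define \<tau>' where "\<tau>' = vector_derivative \<gamma> (at t) \<bullet> w"
    have \<tau>: "(\<tau> has_real_derivative \<tau>') (at t)"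
      using has_derivative_inner_left[OF has_derivative_diff[OF d[unfolded has_vector_derivative_def]
            has_derivative_const[of p]], of w]
      unfolding \<tau>_def[abs_def] \<tau>'_def
      by (simp add: has_field_derivative_def mult_commute_abs)
    have "(parabola \<circ> \<tau> has_vector_derivative (2 * \<tau>') *\<^sub>R ?T) (at t)"
      unfolding parabola_def o_def
      by (rule derivative_eq_intros \<tau> refl)+ (simp add: algebra_simps)
    moreover have "parabola \<circ> \<tau> = \<gamma>" using \<gamma>_eq by auto
    ultimately have v: "vector_derivative \<gamma> (at t) = (2 * \<tau>') *\<^sub>R ?T"
      using vector_derivative_at by blast
    obtain a where a: "vector_derivative \<gamma> (at t) = a *\<^sub>R e t"
      using e unfolding tangent_field_def span_singleton by blast
    have "vector_derivative \<gamma> (at t) \<noteq> 0"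
      using \<gamma> unfolding regular_parametrization_def by blast
    then have "a \<noteq> 0" "\<tau>' \<noteq> 0" using a v by auto
    \<comment> \<open>Obtained by comparing the two expressions \<open>a e\<close> and
      \<open>2 \<tau>' (q + s r)\<close>, at \<open>s = \<tau> t\<close>, for the velocity of
      \<open>\<gamma>\<close>; regularity makes \<open>b\<close> nonzero.\<close>
    define b where "b = 2 * \<tau>' / a"
    have b: "b \<noteq> 0" using \<open>a \<noteq> 0\<close> \<open>\<tau>' \<noteq> 0\<close> by (simp add: b_def)
    have "e t = (1 / a) *\<^sub>R (a *\<^sub>R e t)" using \<open>a \<noteq> 0\<close> by simp
    also have "\<dots> = b *\<^sub>R ?T" unfolding a[symmetric] v by (simp add: b_def)
    finally have "e t = b *\<^sub>R ?T" .
    then show ?thesis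
      unfolding pedal_curve_def foot_def \<gamma>_eq[of t] using b
      by (simp only: inner_scaleR_left inner_scaleR_right scaleR_scaleR) simp
  qed
  have "range \<tau> = UNIV"
  proof -
    have "\<exists>t. s = \<tau> t" for s
    proof -
      obtain t where "parabola s = \<gamma> t" using range by blast
      then have "s = \<tau> t" using w[of s] by (simp add: \<tau>_def)
      then show ?thesis ..
    qed
    then show ?thesis by auto
  qed
  moreover have "range (pedal_curve \<gamma> e 0) = foot ` range \<tau>"
    unfolding image_image by (rule image_cong[OF refl pedal])
  ultimately show ?thesis by simp
qed

end

theorem theoremB:
  fixes f :: "real^2 \<Rightarrow> real^3" and \<gamma> e :: "real \<Rightarrow> real^3"
  assumes "whitney_umbrella f"
    and "regular_parametrization \<gamma> (curvature_parabola f)"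
    and "tangent_field \<gamma> e"
  shows "inversion_image (range (pedal_curve \<gamma> e 0)) = focal_conic f - {0} \<and> 0 \<in> focal_conic f"
proof -
  obtain k X where jet: "frechet_derivative f (at 0) k = 0" "norm (frechet_derivative f (at 0) X) = 1"
    "\<forall>\<alpha> \<beta> \<delta>. \<alpha> *\<^sub>R frechet_derivative f (at 0) X + \<beta> *\<^sub>R second_derivative f 0 X k
      + \<delta> *\<^sub>R second_derivative f 0 k k = 0 \<longrightarrow> \<alpha> = 0 \<and> \<beta> = 0 \<and> \<delta> = 0"
    using whitney_umbrella_jet[OF assms(1)] by blast
  obtain U where U: "open U" "0 \<in> U" "smooth_on f U" "f 0 = 0"
    using assms(1) unfolding whitney_umbrella_def smooth_germ_def by blast
  interpret corank_one_jet f U X k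
    using U jet by (intro corank_one_jet.intro) simp_all
  show ?thesis
    \<comment> \<open>At \<open>x = 0\<close> every inner product in the equation of the conic
      vanishes, which gives membership of 0.\<close>
    using range_pedal_curve[OF assms(2,3)] inversion_image_range_foot mem_focal_conic_iff[of 0] by simp
qed

end
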